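(* Let $(\lambda,a_1,a_2)\in\mathbb{C}^*\times\mathbb{C}^2$ with $a_1+a_2=1$, and let $c\in v\,\mathbb{C}[[v]]$ with $v=y_1y_2$. Consider $$Z=x^2\frac{\partial}{\partial x}+\big(-(\lambda+c(v))+a_1x\big)y_1\frac{\partial}{\partial y_1}+\big(\lambda+c(v)+a_2x\big)y_2\frac{\partial}{\partial y_2}.$$ Then $$\widehat{\mathrm{Isot}}_\omega(Z)=\left\{\mathrm{diag}\left(1,\alpha,\tfrac1\alpha\right)\ :\ \alpha\in\mathbb{C}\setminus\{0\}\right\}\simeq\mathbb{C}\setminus\{0\}.$$
   Context: Coordinates on $\mathbb{C}^3$ are $(x,\mathbf y)=(x,y_1,y_2)$. Formal diffeomorphisms fixing the origin act on singular formal vector fields by $\Phi_*(X)=(\mathrm D\Phi\cdot X)\circ\Phi^{-1}$. $\langle\mathrm dx\rangle$ is the ideal generated by $\mathrm dx$ in the exterior algebra of formal differential forms with coefficients in $\mathbb{C}[[x,\mathbf y]]$, and $\omega:=\frac{\mathrm dy_1\wedge\mathrm dy_2}{x}$. $\widehat{\mathrm{Diff}}_\omega$ is the group of transversally symplectic formal diffeomorphisms: formal diffeomorphisms $\Phi$ of $\mathbb{C}^3$ fixing the origin with $\Phi^*(x)=x$ and $x\Phi^*(\omega)\in x\omega+\langle\mathrm dx\rangle$, i.e. $\Phi^*(\mathrm dy_1\wedge\mathrm dy_2)\in\mathrm dy_1\wedge\mathrm dy_2+\langle\mathrm dx\rangle$. $\widehat{\mathrm{Isot}}_\omega(Z)$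 is the subgroup of elements $\Phi\in\widehat{\mathrm{Diff}}_\omega$ such that $\Phi_*(Z)=Z$. The notation $\mathrm{diag}(1,\alpha,\frac1\alpha)$ stands for the linear map $(x,y_1,y_2)\mapsto(x,\alpha y_1,\alpha^{-1}y_2)$. *)

theory Defs
  imports
    "HOL-Computational_Algebra.Formal_Power_Series"
    "HOL-Algebra.Group"
begin

section \<open>Formal power series in three variables\<close>

text \<open>
  The ring of formal power series in \<open>(x, y\<^sub>1, y\<^sub>2)\<close> over the complex numbers is the
  iterated power series ring: the outermost layer is the expansion in \<open>x\<close>, the middle one
  in \<open>y\<^sub>1\<close> and the innermost one in \<open>y\<^sub>2\<close>.
\<close>

type_synonym ser = "complex fps fps fps"

datatype coord = CX | CY1 | CY2

lemma UNIV_coord: "(UNIV :: coord set) = {CX, CY1, CY2}"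
  by (auto intro: coord.exhaust)

instance coord :: finite
  by standard (simp add: UNIV_coord)

definition mcoeff :: "ser \<Rightarrow> nat \<Rightarrow> nat \<Rightarrow> nat \<Rightarrow> complex" where
  "mcoeff F i j k = fps_nth (fps_nth (fps_nth F i) j) k"

definition mk_ser :: "(nat \<Rightarrow> nat \<Rightarrow> nat \<Rightarrow> complex) \<Rightarrow> ser" where
  "mk_ser f = Abs_fps (\<lambda>i. Abs_fps (\<lambda>j. Abs_fps (\<lambda>k. f i j k)))"

definition ser_const :: "complex \<Rightarrow> ser" where
  "ser_const a = fps_const (fps_const (fps_const a))"

fun var :: "coord \<Rightarrow> ser" where
  "var CX = fps_X"
| "var CY1 = fps_const fps_X"
| "var CY2 = fps_const (fps_const fps_X)"

fun pd :: "coord \<Rightarrow> ser \<Rightarrow> ser" where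
  "pd CX F = mk_ser (\<lambda>i j k. of_nat (Suc i) * mcoeff F (Suc i) j k)"
| "pd CY1 F = mk_ser (\<lambda>i j k. of_nat (Suc j) * mcoeff F i (Suc j) k)"
| "pd CY2 F = mk_ser (\<lambda>i j k. of_nat (Suc k) * mcoeff F i j (Suc k))"

section \<open>Substitution, formal maps and formal diffeomorphisms\<close>

type_synonym fmap = "coord \<Rightarrow> ser"

definition fixes_origin :: "fmap \<Rightarrow> bool" where
  "fixes_origin \<Phi> \<longleftrightarrow> (\<forall>s. mcoeff (\<Phi> s) 0 0 0 = 0)"

text \<open>
  The substitution \<open>F \<circ> \<Phi>\<close>, meaningful when \<open>\<Phi>\<close> fixes the origin. Then
  \<open>\<Phi>\<^sub>x\<^sup>a \<Phi>\<^sub>1\<^sup>b \<Phi>\<^sub>2\<^sup>c\<close> has no term of total degree less than \<open>a + b + c\<close>, so that truncating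
  each of the sums at the total degree \<open>i + j + k\<close> of the coefficient loses nothing.
  The same remark applies to the substitution of \<open>g\<close> into a series in one variable.
\<close>

definition subst :: "ser \<Rightarrow> fmap \<Rightarrow> ser" where
  "subst F \<Phi> = mk_ser (\<lambda>i j k.
     \<Sum>a\<le>i + j + k. \<Sum>b\<le>i + j + k. \<Sum>c\<le>i + j + k.
       mcoeff F a b c * mcoeff (\<Phi> CX ^ a * \<Phi> CY1 ^ b * \<Phi> CY2 ^ c) i j k)"

definition subst1 :: "complex fps \<Rightarrow> ser \<Rightarrow> ser" where
  "subst1 f g = mk_ser (\<lambda>i j k. \<Sum>n\<le>i + j + k. fps_nth f n * mcoeff (g ^ n) i j k)"

text \<open>Since \<open>var\<close> lists the three coordinate functions, it is the identity map.\<close>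

definition fcomp_map :: "fmap \<Rightarrow> fmap \<Rightarrow> fmap" where
  "fcomp_map \<Phi> \<Psi> = (\<lambda>s. subst (\<Phi> s) \<Psi>)"

definition is_finverse :: "fmap \<Rightarrow> fmap \<Rightarrow> bool" where
  "is_finverse \<Phi> \<Psi> \<longleftrightarrow> fixes_origin \<Psi> \<and> fcomp_map \<Phi> \<Psi> = var \<and> fcomp_map \<Psi> \<Phi> = var"

definition fdiffeo :: "fmap \<Rightarrow> bool" where
  "fdiffeo \<Phi> \<longleftrightarrow> fixes_origin \<Phi> \<and> (\<exists>\<Psi>. is_finverse \<Phi> \<Psi>)"

definition finverse :: "fmap \<Rightarrow> fmap" where
  "finverse \<Phi> = (THE \<Psi>. is_finverse \<Phi> \<Psi>)"

section \<open>Vector fields\<close>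

text \<open>A vector field is given by its components along the three coordinate derivations.\<close>

type_synonym vfield = "coord \<Rightarrow> ser"

definition pushforward :: "fmap \<Rightarrow> vfield \<Rightarrow> vfield" where
  "pushforward \<Phi> V = (\<lambda>s. subst (\<Sum>t\<in>UNIV. pd t (\<Phi> s) * V t) (finverse \<Phi>))"

section \<open>Differential forms\<close>

text \<open>
  The exterior algebra is free with basis \<open>dx\<^sub>S\<close>, the wedge product of the coordinate
  differentials indexed by \<open>S\<close> taken in the order \<open>x, y\<^sub>1, y\<^sub>2\<close>. A form is the family of its
  coefficients. In \<open>wedge\<close>, the sign is that of the permutation sorting \<open>dx\<^sub>T dx\<^bsub>S - T\<^esub>\<close>.
\<close>

type_synonym form = "coord set \<Rightarrow> ser"

fun pos :: "coord \<Rightarrow> nat" where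
  "pos CX = 0"
| "pos CY1 = 1"
| "pos CY2 = 2"

definition inversions :: "coord set \<Rightarrow> coord set \<Rightarrow> nat" where
  "inversions T U = card {(s, t). s \<in> T \<and> t \<in> U \<and> pos t < pos s}"

definition wedge :: "form \<Rightarrow> form \<Rightarrow> form" where
  "wedge \<eta> \<theta> = (\<lambda>S. \<Sum>T\<in>Pow S. (- 1) ^ inversions T (S - T) * \<eta> T * \<theta> (S - T))"

definition form_one :: form where
  "form_one = (\<lambda>S. if S = {} then 1 else 0)"

definition d0 :: "ser \<Rightarrow> form" where
  "d0 f = (\<lambda>S. \<Sum>s\<in>UNIV. if S = {s} then pd s f else 0)"

definition pullback :: "fmap \<Rightarrow> form \<Rightarrow> form" where
  "pullback \<Phi> \<eta> = (\<lambda>T. \<Sum>S\<in>UNIV. subst (\<eta> S) \<Phi> *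
     foldr (\<lambda>s. wedge (d0 (\<Phi> s))) (filter (\<lambda>s. s \<in> S) [CX, CY1, CY2]) form_one T)"

definition form_ideal :: "form set \<Rightarrow> bool" where
  "form_ideal J \<longleftrightarrow> (\<lambda>S. 0) \<in> J
     \<and> (\<forall>\<eta>\<in>J. \<forall>\<theta>\<in>J. (\<lambda>S. \<eta> S + \<theta> S) \<in> J)
     \<and> (\<forall>\<eta>\<in>J. \<forall>\<theta>. wedge \<theta> \<eta> \<in> J \<and> wedge \<eta> \<theta> \<in> J)"

definition ideal_dx :: "form set" where
  "ideal_dx = \<Inter>{J. form_ideal J \<and> d0 (var CX) \<in> J}"

definition dy1_dy2 :: form where
  "dy1_dy2 = wedge (d0 (var CY1)) (d0 (var CY2))"

section \<open>Transversally symplectic diffeomorphisms and isotropies\<close>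

text \<open>
  As \<open>\<omega> = dy\<^sub>1 \<and> dy\<^sub>2 / x\<close> has a pole, preservation of \<open>\<omega>\<close> modulo \<open>dx\<close> is expressed after
  multiplication by \<open>x\<close>, which \<open>\<Phi>\<close> preserves.
\<close>

definition Diff_omega :: "fmap set" where
  "Diff_omega = {\<Phi>. fdiffeo \<Phi> \<and> subst (var CX) \<Phi> = var CX
     \<and> (\<lambda>S. pullback \<Phi> dy1_dy2 S - dy1_dy2 S) \<in> ideal_dx}"

definition Isot_omega :: "vfield \<Rightarrow> fmap set" where
  "Isot_omega Z = {\<Phi> \<in> Diff_omega. pushforward \<Phi> Z = Z}"

definition Isot_group :: "vfield \<Rightarrow> fmap monoid" where
  "Isot_group Z = \<lparr>carrier = Isot_omega Z, mult = fcomp_map, one = var\<rparr>"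

definition Cstar :: "complex monoid" where
  "Cstar = \<lparr>carrier = UNIV - {0}, mult = (*), one = 1\<rparr>"

fun diag :: "complex \<Rightarrow> complex \<Rightarrow> complex \<Rightarrow> fmap" where
  "diag a b c CX = ser_const a * var CX"
| "diag a b c CY1 = ser_const b * var CY1"
| "diag a b c CY2 = ser_const c * var CY2"

fun Zfield :: "complex \<Rightarrow> complex \<Rightarrow> complex \<Rightarrow> complex fps \<Rightarrow> vfield" where
  "Zfield l a1 a2 c CX = var CX ^ 2"
| "Zfield l a1 a2 c CY1 =
     (- (ser_const l + subst1 c (var CY1 * var CY2)) + ser_const a1 * var CX) * var CY1"
| "Zfield l a1 a2 c CY2 =
     (ser_const l + subst1 c (var CY1 * var CY2) + ser_const a2 * var CX) * var CY2"

end

theory Submission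
  imports Defs
begin

text \<open>
  Write \<open>v = y\<^sub>1 y\<^sub>2\<close> and \<open>\<Phi> = (x, \<phi>\<^sub>1, \<phi>\<^sub>2)\<close>. Invariance of \<open>Z\<close> says \<open>Z \<cdot> \<phi>\<^sub>1 = (- (\<lambda> + c(w)) + a\<^sub>1 x) \<phi>\<^sub>1\<close>
  and \<open>Z \<cdot> \<phi>\<^sub>2 = (\<lambda> + c(w) + a\<^sub>2 x) \<phi>\<^sub>2\<close> with \<open>w = \<phi>\<^sub>1 \<phi>\<^sub>2\<close>, so that \<open>Z \<cdot> w = x w\<close>. Equations
  \<open>Z \<cdot> F = (m (\<lambda> + c(v)) + s x) F\<close> are diagonal on monomials: only \<open>x\<^sup>i y\<^sub>1\<^sup>j y\<^sub>2\<^sup>k\<close> with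
  \<open>k - j = m\<close> and \<open>i + a\<^sub>1 j + a\<^sub>2 k = s\<close> can occur in \<open>F\<close>. This gives \<open>w = \<beta> v\<close>, the Jacobian
  condition at the origin forces \<open>\<beta> = 1\<close>, hence \<open>c(w) = c(v)\<close>, and then \<open>\<phi>\<^sub>1\<close> and \<open>\<phi>\<^sub>2\<close> solve equations
  of the same diagonal kind, whose solutions are the multiples of \<open>y\<^sub>1\<close> and \<open>y\<^sub>2\<close>.
\<close>

section \<open>Coefficients\<close>

lemma mcoeff_mk_ser [simp]: "mcoeff (mk_ser f) i j k = f i j k"
  by (simp add: mcoeff_def mk_ser_def)

lemma ser_eqI: "(\<And>i j k. mcoeff F i j k = mcoeff G i j k) \<Longrightarrow> F = G"
  by (simp add: mcoeff_def fps_eq_iff)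

lemma mcoeff_add [simp]: "mcoeff (F + G) i j k = mcoeff F i j k + mcoeff G i j k"
  and mcoeff_diff [simp]: "mcoeff (F - G) i j k = mcoeff F i j k - mcoeff G i j k"
  and mcoeff_uminus [simp]: "mcoeff (- F) i j k = - mcoeff F i j k"
  and mcoeff_zero [simp]: "mcoeff 0 i j k = 0"
  and mcoeff_one: "mcoeff 1 i j k = (if i = 0 \<and> j = 0 \<and> k = 0 then 1 else 0)"
  by (simp_all add: mcoeff_def)

lemma mcoeff_sum [simp]: "mcoeff (sum f A) i j k = (\<Sum>p\<in>A. mcoeff (f p) i j k)"
  by (induction A rule: infinite_finite_induct) simp_all

lemma mcoeff_mult:
  "mcoeff (F * G) i j k =
    (\<Sum>a\<le>i. \<Sum>b\<le>j. \<Sum>c\<le>k. mcoeff F a b c * mcoeff G (i - a) (j - b) (k - c))"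
  by (simp add: mcoeff_def fps_mult_nth fps_sum_nth atLeast0AtMost)

lemma mcoeff_ser_const_mult [simp]: "mcoeff (ser_const a * F) i j k = a * mcoeff F i j k"
  by (simp add: mcoeff_def ser_const_def)

lemma ser_const_simps [simp]:
  "ser_const 1 = 1" "ser_const 0 = 0"
  by (simp_all add: ser_const_def)

lemma ser_const_mult: "ser_const a * ser_const b = ser_const (a * b)"
  by (simp add: ser_const_def fps_const_mult)

lemma mcoeff_ser_const: "mcoeff (ser_const a) i j k = (if i = 0 \<and> j = 0 \<and> k = 0 then a else 0)"
  using mcoeff_ser_const_mult[of a 1] by (simp add: mcoeff_one)

lemma mcoeff_CX_mult: "mcoeff (var CX * F) i j k = (if i = 0 then 0 else mcoeff F (i - 1) j k)"
  and mcoeff_CY1_mult: "mcoeff (var CY1 * F) i j k = (if j = 0 then 0 else mcoeff F i (j - 1) k)"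
  and mcoeff_CY2_mult: "mcoeff (var CY2 * F) i j k = (if k = 0 then 0 else mcoeff F i j (k - 1))"
  by (simp_all add: mcoeff_def)

lemma mcoeff_var:
  "mcoeff (var s) i j k =
    (if i = (if s = CX then 1 else 0) \<and> j = (if s = CY1 then 1 else 0)
      \<and> k = (if s = CY2 then 1 else 0) then 1 else 0)"
  by (cases s) (auto simp: mcoeff_def fps_X_def)

lemma fixes_origin_var: "fixes_origin var"
  unfolding fixes_origin_def mcoeff_var by (metis (full_types) coord.exhaust zero_neq_one)

section \<open>Substitution is a ring homomorphism\<close>

text \<open>The image of a monomial under substitution. For \<open>\<Phi> = var\<close> it is the
  monomial itself, so one formula expands both a series and its substitution.\<close>

definition mpow :: "fmap \<Rightarrow> nat \<times> nat \<times> nat \<Rightarrow> ser" where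
  "mpow \<Phi> = (\<lambda>(a, b, c). \<Phi> CX ^ a * \<Phi> CY1 ^ b * \<Phi> CY2 ^ c)"

definition mcoeff3 :: "ser \<Rightarrow> nat \<times> nat \<times> nat \<Rightarrow> complex" where
  "mcoeff3 F = (\<lambda>(a, b, c). mcoeff F a b c)"

text \<open>A cube of exponents rather than a simplex, to match the three independent truncations in
  \<open>subst\<close>.\<close>

definition box :: "nat \<Rightarrow> (nat \<times> nat \<times> nat) set" where
  "box N = {..N} \<times> {..N} \<times> {..N}"

text \<open>Membership in the d-th power of the maximal ideal.\<close>

definition low :: "nat \<Rightarrow> ser \<Rightarrow> bool" where
  "low d F \<longleftrightarrow> (\<forall>i j k. i + j + k < d \<longrightarrow> mcoeff F i j k = 0)"

text \<open>Congruence modulo the (N+1)-st power of the maximal ideal: degree N itself is still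
  compared.\<close>

definition ceq :: "nat \<Rightarrow> ser \<Rightarrow> ser \<Rightarrow> bool" where
  "ceq N F G \<longleftrightarrow> (\<forall>i j k. i + j + k \<le> N \<longrightarrow> mcoeff F i j k = mcoeff G i j k)"

section \<open>Orders and congruences under products\<close>

lemma finite_box [simp]: "finite (box N)"
  by (simp add: box_def)

lemma low_mult:
  assumes "low d F" "low e G"
  shows "low (d + e) (F * G)"
  unfolding low_def
proof (intro allI impI)
  fix i j k :: nat
  assume ijk: "i + j + k < d + e"
  have "mcoeff F a b c * mcoeff G (i - a) (j - b) (k - c) = 0"
    if "a \<le> i" "b \<le> j" "c \<le> k" for a b c
  proof (cases "a + b + c < d")
    case False
    then have "(i - a) + (j - b) + (k - c) < e"
      using that ijk by linarith
    then show ?thesis using assms(2) by (simp add: low_def)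
  qed (use assms(1) in \<open>simp add: low_def\<close>)
  then show "mcoeff (F * G) i j k = 0"
    unfolding mcoeff_mult by (intro sum.neutral ballI) simp
qed

lemma low_power: "low 1 F \<Longrightarrow> low n (F ^ n)"
proof (induction n)
  case (Suc n)
  then show ?case using low_mult[of 1 F n "F ^ n"] by simp
qed (simp add: low_def)

lemma fixes_origin_low: "fixes_origin \<Phi> \<longleftrightarrow> (\<forall>s. low 1 (\<Phi> s))"
  by (simp add: fixes_origin_def low_def)

lemma low_mpow: "fixes_origin \<Phi> \<Longrightarrow> low (a + b + c) (mpow \<Phi> (a, b, c))"
  by (simp add: mpow_def fixes_origin_low low_mult low_power)

lemma ceq_refl [simp]: "ceq N F F"
  and ceq_sym: "ceq N F G \<Longrightarrow> ceq N G F"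
  and ceq_trans [trans]: "ceq N F G \<Longrightarrow> ceq N G H \<Longrightarrow> ceq N F H"
  by (simp_all add: ceq_def)

lemma ceq_mult:
  assumes "ceq N F F'" "ceq N G G'"
  shows "ceq N (F * G) (F' * G')"
  unfolding ceq_def mcoeff_mult
proof (intro allI impI sum.cong refl)
  fix i j k a b c
  assume "i + j + k \<le> N" "a \<in> {..i}" "b \<in> {..j}" "c \<in> {..k}"
  then have "a + b + c \<le> N" "(i - a) + (j - b) + (k - c) \<le> N" by auto
  then show "mcoeff F a b c * mcoeff G (i - a) (j - b) (k - c)
      = mcoeff F' a b c * mcoeff G' (i - a) (j - b) (k - c)"
    using assms by (simp add: ceq_def)
qed

lemma ceq_all: "(\<And>N. ceq N F G) \<Longrightarrow> F = G"
  by (rule ser_eqI) (auto simp: ceq_def)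

section \<open>Substitution as a limit of polynomial substitutions\<close>

lemma mcoeff_subst:
  "mcoeff (subst F \<Phi>) i j k = (\<Sum>p\<in>box (i + j + k). mcoeff3 F p * mcoeff (mpow \<Phi> p) i j k)"
  by (simp add: subst_def box_def mcoeff3_def mpow_def sum.cartesian_product case_prod_unfold)

text \<open>The truncation in \<open>subst\<close> varies with the coefficient. Monomials outside
  the smaller box have too high an order to contribute, so one finite sum serves all degrees up to
  N.\<close>

lemma ceq_subst:
  assumes "fixes_origin \<Phi>"
  shows "ceq N (subst F \<Phi>) (\<Sum>p\<in>box N. ser_const (mcoeff3 F p) * mpow \<Phi> p)"
  unfolding ceq_def
proof (intro allI impI)
  fix i j k :: nat
  assume N: "i + j + k \<le> N"
  have "mcoeff (mpow \<Phi> p) i j k = 0" if "p \<in> box N - box (i + j + k)" for p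
  proof -
    obtain a b c where p: "p = (a, b, c)" by (cases p)
    then have "i + j + k < a + b + c" using that by (auto simp: box_def)
    then show ?thesis using low_mpow[OF assms] by (simp add: p low_def)
  qed
  moreover have "box (i + j + k) \<subseteq> box N" using N by (auto simp: box_def)
  ultimately have "(\<Sum>p\<in>box (i + j + k). mcoeff3 F p * mcoeff (mpow \<Phi> p) i j k)
      = (\<Sum>p\<in>box N. mcoeff3 F p * mcoeff (mpow \<Phi> p) i j k)"
    by (intro sum.mono_neutral_left) auto
  then show "mcoeff (subst F \<Phi>) i j k
      = mcoeff (\<Sum>p\<in>box N. ser_const (mcoeff3 F p) * mpow \<Phi> p) i j k"
    by (simp add: mcoeff_subst)
qed

text \<open>Continuity in the adic topology: as \<open>\<Phi>\<close> has no constant terms,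
  monomials of degree above N only reach degrees above N.\<close>

lemma subst_ceq_cong:
  assumes "fixes_origin \<Phi>" "ceq N F G"
  shows "ceq N (subst F \<Phi>) (subst G \<Phi>)"
  unfolding ceq_def mcoeff_subst
proof (intro allI impI sum.cong refl)
  fix i j k :: nat and p
  assume N: "i + j + k \<le> N" and "p \<in> box (i + j + k)"
  obtain a b c where p: "p = (a, b, c)" by (cases p)
  show "mcoeff3 F p * mcoeff (mpow \<Phi> p) i j k = mcoeff3 G p * mcoeff (mpow \<Phi> p) i j k"
  proof (cases "a + b + c \<le> N")
    case True
    then show ?thesis using assms(2) by (simp add: p mcoeff3_def ceq_def)
  next
    case False
    then show ?thesis using low_mpow[OF assms(1), of a b c] N by (simp add: p low_def)
  qed
qed

lemma subst_add: "subst (F + G) \<Phi> = subst F \<Phi> + subst G \<Phi>"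
  and subst_diff: "subst (F - G) \<Phi> = subst F \<Phi> - subst G \<Phi>"
  and subst_uminus: "subst (- F) \<Phi> = - subst F \<Phi>"
  and subst_zero [simp]: "subst 0 \<Phi> = 0"
  and subst_scale: "subst (ser_const a * F) \<Phi> = ser_const a * subst F \<Phi>"
  by (rule ser_eqI; simp add: mcoeff_subst mcoeff3_def case_prod_unfold sum.distrib sum_subtractf sum_negf
        sum_distrib_left distrib_right left_diff_distrib mult.assoc)+

lemma subst_sum: "subst (sum f A) \<Phi> = (\<Sum>p\<in>A. subst (f p) \<Phi>)"
  by (induction A rule: infinite_finite_induct) (simp_all add: subst_add)

lemma mcoeff_mpow_var:
  "mcoeff (mpow var (a, b, c)) i j k = (if i = a \<and> j = b \<and> k = c then 1 else 0)"
proof -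
  have "mpow var (a, b, c) = fps_X ^ a * fps_const (fps_X ^ b * fps_const (fps_X ^ c))"
    by (simp add: mpow_def fps_const_power mult.assoc flip: fps_const_mult)
  then show ?thesis by (simp add: mcoeff_def fps_X_power_nth)
qed

lemma mcoeff3_mpow_var: "mcoeff3 (mpow var p) q = (if p = q then 1 else 0)"
  by (cases p; cases q) (auto simp: mcoeff3_def mcoeff_mpow_var)

lemma ceq_expand: "ceq N F (\<Sum>p\<in>box N. ser_const (mcoeff3 F p) * mpow var p)"
  unfolding ceq_def
proof (intro allI impI)
  fix i j k :: nat
  assume "i + j + k \<le> N"
  then have mem: "(i, j, k) \<in> box N" by (auto simp: box_def)
  have eq: "mcoeff (mpow var p) i j k = (if p = (i, j, k) then 1 else 0)" for p
    by (cases p) (auto simp: mcoeff_mpow_var)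
  show "mcoeff F i j k = mcoeff (\<Sum>p\<in>box N. ser_const (mcoeff3 F p) * mpow var p) i j k"
    using mem by (simp add: eq mcoeff3_def if_distrib sum.delta' cong: if_cong)
qed

lemma subst_mpow_var:
  assumes "fixes_origin \<Phi>"
  shows "subst (mpow var p) \<Phi> = mpow \<Phi> p"
proof (rule ser_eqI)
  fix i j k
  obtain a b c where p: "p = (a, b, c)" by (cases p)
  have "mcoeff (mpow \<Phi> p) i j k = 0" if "p \<notin> box (i + j + k)"
  proof -
    have "i + j + k < a + b + c" using that by (auto simp: box_def p)
    then show ?thesis using low_mpow[OF assms] by (simp add: p low_def)
  qed
  then show "mcoeff (subst (mpow var p) \<Phi>) i j k = mcoeff (mpow \<Phi> p) i j k"
    by (auto simp: mcoeff_subst mcoeff3_mpow_var if_distrib[of "\<lambda>x. x * _"] cong: if_cong)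
qed

lemma mpow_mult:
  "mpow \<Phi> p * mpow \<Phi> q = mpow \<Phi> (fst p + fst q, fst (snd p) + fst (snd q), snd (snd p) + snd (snd q))"
  by (simp add: mpow_def case_prod_unfold power_add algebra_simps)

text \<open>Modulo each degree both factors are polynomials, where the claim is bilinear extension
  of \<open>mpow_mult\<close>. The expansion \<open>P\<close> is used at \<open>var\<close> before
  substituting and at \<open>\<Phi>\<close> after.\<close>

lemma subst_mult:
  assumes "fixes_origin \<Phi>"
  shows "subst (F * G) \<Phi> = subst F \<Phi> * subst G \<Phi>"
proof (rule ceq_all)
  fix N
  let ?P = "\<lambda>F \<Psi>. \<Sum>p\<in>box N. ser_const (mcoeff3 F p) * mpow \<Psi> p"
  have P: "?P F \<Psi> * ?P G \<Psi> = (\<Sum>p\<in>box N. \<Sum>q\<in>box N. ser_const (mcoeff3 F p * mcoeff3 G q)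
      * mpow \<Psi> (fst p + fst q, fst (snd p) + fst (snd q), snd (snd p) + snd (snd q)))" for \<Psi>
    by (simp add: sum_product ser_const_mult[symmetric] mpow_mult[symmetric] mult_ac)
  have "ceq N (subst (F * G) \<Phi>) (subst (?P F var * ?P G var) \<Phi>)"
    by (intro subst_ceq_cong assms ceq_mult ceq_expand)
  also have "subst (?P F var * ?P G var) \<Phi> = ?P F \<Phi> * ?P G \<Phi>"
    by (simp only: P subst_sum subst_scale subst_mpow_var[OF assms])
  also have "ceq N (?P F \<Phi> * ?P G \<Phi>) (subst F \<Phi> * subst G \<Phi>)"
    by (intro ceq_mult ceq_sym[OF ceq_subst] assms)
  finally show "ceq N (subst (F * G) \<Phi>) (subst F \<Phi> * subst G \<Phi>)" .
qed

lemma subst_one [simp]: "fixes_origin \<Phi> \<Longrightarrow> subst 1 \<Phi> = 1"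
  using subst_mpow_var[of \<Phi> "(0, 0, 0)"] by (simp add: mpow_def)

lemma subst_ser_const: "fixes_origin \<Phi> \<Longrightarrow> subst (ser_const a) \<Phi> = ser_const a"
  using subst_scale[of a 1 \<Phi>] by simp

lemma subst_power: "fixes_origin \<Phi> \<Longrightarrow> subst (F ^ n) \<Phi> = subst F \<Phi> ^ n"
  by (induction n) (simp_all add: subst_mult)

lemma subst_var:
  assumes "fixes_origin \<Phi>"
  shows "subst (var s) \<Phi> = \<Phi> s"
  using subst_mpow_var[OF assms, of "(1, 0, 0)"] subst_mpow_var[OF assms, of "(0, 1, 0)"]
    subst_mpow_var[OF assms, of "(0, 0, 1)"]
  by (cases s) (simp_all add: mpow_def)

section \<open>Composition and inversion of formal maps\<close>

lemma subst_mpow: "fixes_origin \<Psi> \<Longrightarrow> subst (mpow \<Phi> p) \<Psi> = mpow (fcomp_map \<Phi> \<Psi>) p"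
  by (simp add: mpow_def fcomp_map_def case_prod_unfold subst_mult subst_power)

lemma fixes_origin_fcomp_map:
  "fixes_origin \<Phi> \<Longrightarrow> fixes_origin (fcomp_map \<Phi> \<Psi>)"
  by (simp add: fixes_origin_def fcomp_map_def mcoeff_subst box_def mcoeff3_def)

text \<open>Modulo each degree the inner substitution is a polynomial in the components of
  \<open>\<Phi>\<close>, through which the ring homomorphism given by \<open>\<Psi>\<close>
  passes.\<close>

lemma subst_subst:
  assumes "fixes_origin \<Phi>" "fixes_origin \<Psi>"
  shows "subst (subst F \<Phi>) \<Psi> = subst F (fcomp_map \<Phi> \<Psi>)"
proof (rule ceq_all)
  fix N
  have "ceq N (subst (subst F \<Phi>) \<Psi>)
      (subst (\<Sum>p\<in>box N. ser_const (mcoeff3 F p) * mpow \<Phi> p) \<Psi>)"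
    by (intro subst_ceq_cong ceq_subst assms)
  also have "subst (\<Sum>p\<in>box N. ser_const (mcoeff3 F p) * mpow \<Phi> p) \<Psi>
      = (\<Sum>p\<in>box N. ser_const (mcoeff3 F p) * mpow (fcomp_map \<Phi> \<Psi>) p)"
    by (simp add: subst_sum subst_scale subst_mpow assms)
  also have "ceq N \<dots> (subst F (fcomp_map \<Phi> \<Psi>))"
    by (intro ceq_sym[OF ceq_subst] fixes_origin_fcomp_map assms)
  finally show "ceq N (subst (subst F \<Phi>) \<Psi>) (subst F (fcomp_map \<Phi> \<Psi>))" .
qed

lemma subst_var_right: "subst F var = F"
proof (rule ceq_all)
  fix N
  show "ceq N (subst F var) F"
    by (rule ceq_trans[OF ceq_subst[OF fixes_origin_var] ceq_sym[OF ceq_expand]])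
qed

text \<open>A left inverse equals a right inverse by associativity. This makes the definite
  description in \<open>finverse\<close> meaningful.\<close>

lemma is_finverse_unique:
  assumes "fixes_origin \<Phi>" "is_finverse \<Phi> \<Psi>" "is_finverse \<Phi> \<Psi>'"
  shows "\<Psi>' = \<Psi>"
proof
  fix s
  have fo: "fixes_origin \<Psi>" using assms(2) by (simp add: is_finverse_def)
  have "\<Psi>' s = subst (\<Psi>' s) (fcomp_map \<Phi> \<Psi>)"
    using assms(2) by (simp add: is_finverse_def subst_var_right)
  also have "\<dots> = subst (fcomp_map \<Psi>' \<Phi> s) \<Psi>"
    by (simp only: subst_subst[OF assms(1) fo] fcomp_map_def[of \<Psi>' \<Phi>])
  also have "fcomp_map \<Psi>' \<Phi> s = var s"
    using assms(3) by (simp add: is_finverse_def)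
  also have "subst (var s) \<Psi> = \<Psi> s"
    using assms(2) by (simp add: is_finverse_def subst_var)
  finally show "\<Psi>' s = \<Psi> s" .
qed

lemma is_finverse_finverse:
  assumes "fdiffeo \<Phi>"
  shows "is_finverse \<Phi> (finverse \<Phi>)"
  using assms is_finverse_unique[of \<Phi>] unfolding fdiffeo_def finverse_def
  by (metis theI)

text \<open>Composing with \<open>\<Phi>\<close> on the right removes the inverse from the
  definition.\<close>

lemma pushforward_eq_iff:
  assumes "fdiffeo \<Phi>"
  shows "pushforward \<Phi> V = W \<longleftrightarrow> (\<forall>s. (\<Sum>t\<in>UNIV. pd t (\<Phi> s) * V t) = subst (W s) \<Phi>)"
proof -
  have fo: "fixes_origin \<Phi>" "fixes_origin (finverse \<Phi>)"
    and inv: "fcomp_map \<Phi> (finverse \<Phi>) = var" "fcomp_map (finverse \<Phi>) \<Phi> = var"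
    using assms is_finverse_finverse[OF assms] by (simp_all add: fdiffeo_def is_finverse_def)
  have "subst F (finverse \<Phi>) = G \<longleftrightarrow> F = subst G \<Phi>" for F G
    using subst_subst[OF fo, of G] subst_subst[OF fo(2,1), of F]
    by (auto simp: inv subst_var_right)
  then show ?thesis by (auto simp: pushforward_def fun_eq_iff)
qed

section \<open>Derivations\<close>

text \<open>The derivation attached to V; \<open>der V (\<Phi> s)\<close> is a component of the
  pushforward before composition with the inverse.\<close>

definition der :: "vfield \<Rightarrow> ser \<Rightarrow> ser" where
  "der V F = (\<Sum>t\<in>UNIV. pd t F * V t)"

lemma der_expand: "der V F = pd CX F * V CX + pd CY1 F * V CY1 + pd CY2 F * V CY2"
  by (simp add: der_def UNIV_coord add.assoc)

lemma pd_CX_eq: "pd CX F = fps_deriv F"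
  and pd_CY1_nth: "fps_nth (pd CY1 F) i = fps_deriv (fps_nth F i)"
  and pd_CY2_nth: "fps_nth (fps_nth (pd CY2 F) i) j = fps_deriv (fps_nth (fps_nth F i) j)"
  by (simp_all add: fps_eq_iff mk_ser_def mcoeff_def fps_of_nat[symmetric]
       del: fps_of_nat of_nat_Suc)

text \<open>Each partial derivative is \<open>fps_deriv\<close> on one layer of the iterated series,
  so the one-variable Leibniz rule is summed over the Cauchy products of the layers outside
  it.\<close>

lemma pd_mult: "pd t (F * G) = F * pd t G + pd t F * G"
proof (cases t)
  case CX
  then show ?thesis by (simp only: pd_CX_eq fps_deriv_mult)
next
  case CY1
  show ?thesis unfolding CY1
    by (rule fps_ext)
      (simp add: pd_CY1_nth fps_mult_nth fps_deriv_sum sum.distrib del: pd.simps)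
next
  case CY2
  show ?thesis unfolding CY2
    by (rule fps_ext, rule fps_ext)
      (simp add: pd_CY2_nth fps_mult_nth fps_sum_nth fps_deriv_sum sum.distrib del: pd.simps)
qed

lemma der_mult: "der V (F * G) = F * der V G + der V F * G"
  by (simp add: der_expand pd_mult algebra_simps del: pd.simps)

lemma mcoeff_pd_mult_var:
  "mcoeff (pd CX F * var CX) i j k = of_nat i * mcoeff F i j k"
  "mcoeff (pd CY1 F * var CY1) i j k = of_nat j * mcoeff F i j k"
  "mcoeff (pd CY2 F * var CY2) i j k = of_nat k * mcoeff F i j k"
  by (simp_all add: mcoeff_CX_mult mcoeff_CY1_mult mcoeff_CY2_mult mult.commute[of _ "var _"]
        del: var.simps of_nat_Suc)

section \<open>Eigenvalue equations for the vector field\<close>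

abbreviation cser :: "complex fps \<Rightarrow> ser" where
  "cser c \<equiv> subst1 c (var CY1 * var CY2)"

lemma mcoeff_cser: "mcoeff (cser c) i j k = (if i = 0 \<and> j = k then fps_nth c j else 0)"
proof -
  have "(var CY1 * var CY2) ^ n = mpow var (0, n, n)" for n
    by (simp add: mpow_def power_mult_distrib)
  then show ?thesis
    by (auto simp: subst1_def mcoeff_mpow_var if_distrib[of "\<lambda>x. _ * x"] simp del: var.simps
        intro!: sum.neutral cong: if_cong)
qed

text \<open>Only the exponents (0, n, n) occur in \<open>cser c\<close>, so the triple sum in
  \<open>subst\<close> collapses to the single sum in \<open>subst1\<close>, with the same
  truncation.\<close>

lemma subst_cser: "subst (cser c) \<Phi> = subst1 c (\<Phi> CY1 * \<Phi> CY2)"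
proof (rule ser_eqI)
  fix i j k :: nat
  let ?N = "i + j + k"
  let ?M = "\<lambda>a b d. mcoeff (\<Phi> CX ^ a * \<Phi> CY1 ^ b * \<Phi> CY2 ^ d) i j k"
  have "(\<Sum>d\<le>?N. mcoeff (cser c) a b d * ?M a b d)
      = (if a = 0 then fps_nth c b * ?M 0 b b else 0)" if "b \<le> ?N" for a b
  proof -
    have "(\<Sum>d\<le>?N. mcoeff (cser c) a b d * ?M a b d)
        = (\<Sum>d\<le>?N. if d = b then if a = 0 then fps_nth c b * ?M 0 b b else 0 else 0)"
      by (intro sum.cong refl) (auto simp: mcoeff_cser simp del: var.simps)
    then show ?thesis using that by simp
  qed
  then have "mcoeff (subst (cser c) \<Phi>) i j k
      = (\<Sum>a\<le>?N. \<Sum>b\<le>?N. if a = 0 then fps_nth c b * ?M 0 b b else 0)"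
    by (simp add: subst_def del: var.simps)
  also have "\<dots> = (\<Sum>a\<le>?N. if a = 0 then \<Sum>b\<le>?N. fps_nth c b * ?M 0 b b else 0)"
    by (intro sum.cong) simp_all
  finally show "mcoeff (subst (cser c) \<Phi>) i j k = mcoeff (subst1 c (\<Phi> CY1 * \<Phi> CY2)) i j k"
    by (simp add: subst1_def power_mult_distrib)
qed

text \<open>The field x d/dx + a1 y1 d/dy1 + a2 y2 d/dy2, diagonal on monomials.\<close>

definition euler :: "complex \<Rightarrow> complex \<Rightarrow> ser \<Rightarrow> ser" where
  "euler a1 a2 F = mk_ser (\<lambda>i j k. (of_nat i + a1 * of_nat j + a2 * of_nat k) * mcoeff F i j k)"

text \<open>The field y2 d/dy2 - y1 d/dy1, also diagonal on monomials. Then Z is x times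
  \<open>euler\<close> plus (l + c(v)) times this one.\<close>

definition weight :: "ser \<Rightarrow> ser" where
  "weight F = mk_ser (\<lambda>i j k. (of_nat k - of_nat j) * mcoeff F i j k)"

lemma der_Zfield:
  "der (Zfield l a1 a2 c) F = var CX * euler a1 a2 F + (ser_const l + cser c) * weight F"
proof -
  let ?x = "pd CX F * var CX" and ?y = "pd CY1 F * var CY1" and ?z = "pd CY2 F * var CY2"
  have E: "euler a1 a2 F = ?x + ser_const a1 * ?y + ser_const a2 * ?z"
    by (rule ser_eqI) (simp add: euler_def mcoeff_pd_mult_var distrib_right mult.assoc del: var.simps pd.simps)
  have W: "weight F = ?z - ?y"
    by (rule ser_eqI) (simp add: weight_def mcoeff_pd_mult_var left_diff_distrib del: var.simps pd.simps)
  show ?thesis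
    unfolding E W
    by (simp add: der_expand algebra_simps power2_eq_square del: var.simps pd.simps)
qed

text \<open>With G and H the defects of F from being an eigenvector of \<open>weight\<close> and
  \<open>euler\<close>, the equation reads x H + (l + c(v)) G = 0. Induction on the degree gives G =
  0 because l is nonzero, and then H = 0.\<close>

lemma Zfield_eigen:
  assumes "l \<noteq> 0" "fps_nth c 0 = 0"
    and eq: "der (Zfield l a1 a2 c) F
      = (ser_const m * (ser_const l + cser c) + ser_const s * var CX) * F"
  shows "(of_nat k - of_nat j - m) * mcoeff F i j k = 0"
    and "(of_nat i + a1 * of_nat j + a2 * of_nat k - s) * mcoeff F i j k = 0"
proof -
  define G where "G = weight F - ser_const m * F"
  define H where "H = euler a1 a2 F - ser_const s * F"
  have g: "mcoeff G i j k = (of_nat k - of_nat j - m) * mcoeff F i j k" for i j k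
    by (simp add: G_def weight_def left_diff_distrib)
  have h: "mcoeff H i j k = (of_nat i + a1 * of_nat j + a2 * of_nat k - s) * mcoeff F i j k" for i j k
    by (simp add: H_def euler_def left_diff_distrib distrib_right)
  have eq0: "var CX * H + (ser_const l + cser c) * G = 0"
    using eq unfolding der_Zfield G_def H_def by (simp add: algebra_simps del: var.simps)
  have g0: "mcoeff G i j k = 0" for i j k
  proof (induction "i + j + k" arbitrary: i j k rule: less_induct)
    case less
    show ?case
    proof (cases "of_nat k - of_nat j - m = 0")
      case False
      have nz: "of_nat k - of_nat j - m \<noteq> 0" by fact
      have "mcoeff (var CX * H) i j k = 0"
      proof (cases i)
        case (Suc i')
        \<comment> \<open>The factor k - j - m ignores the exponent of x and is nonzero, so this
          smaller monomial is absent from F and hence from H.\<close>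
        then have "mcoeff G i' j k = 0" using less by simp
        then show ?thesis using nz by (simp add: Suc mcoeff_CX_mult g h del: var.simps)
      qed (simp add: mcoeff_CX_mult del: var.simps)
      \<comment> \<open>Terms of positive degree in c(v) fall under the induction hypothesis; the
        remaining one carries c(0) = 0.\<close>
      moreover have "mcoeff (cser c * G) i j k = 0"
        unfolding mcoeff_mult
      proof (intro sum.neutral ballI)
        fix a b d assume *: "a \<in> {..i}" "b \<in> {..j}" "d \<in> {..k}"
        show "mcoeff (cser c) a b d * mcoeff G (i - a) (j - b) (k - d) = 0"
        proof (cases "a + b + d = 0")
          case True
          then show ?thesis using assms(2) by (simp add: mcoeff_cser del: var.simps)
        next
          case False
          then have "i - a + (j - b) + (k - d) < i + j + k" using * by auto
          then show ?thesis using less[of "i - a" "j - b" "k - d"] by simp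
        qed
      qed
      ultimately have "l * mcoeff G i j k = 0"
        using arg_cong[OF eq0, of "\<lambda>F. mcoeff F i j k"] by (simp add: distrib_right del: var.simps)
      then show ?thesis using assms(1) by simp
    qed (simp add: g)
  qed
  then show "(of_nat k - of_nat j - m) * mcoeff F i j k = 0" by (simp add: g)
  from g0 have "G = 0" by (intro ser_eqI) simp
  \<comment> \<open>What remains is x H = 0 in an integral domain.\<close>
  with eq0 have "H = 0" by simp
  then show "(of_nat i + a1 * of_nat j + a2 * of_nat k - s) * mcoeff F i j k = 0"
    by (simp flip: h)
qed

section \<open>The symplectic condition\<close>

text \<open>The \<open>foldr\<close> in \<open>pullback\<close> ends in
  \<open>form_one\<close>.\<close>

lemma wedge_form_one: "wedge \<eta> form_one = \<eta>"
proof
  fix S :: "coord set"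
  have "inversions S {} = 0" by (simp add: inversions_def)
  then have "wedge \<eta> form_one S = (\<Sum>T\<in>Pow S. if T = S then \<eta> S else 0)"
    unfolding wedge_def
    by (intro sum.cong refl) (auto simp: form_one_def)
  then show "wedge \<eta> form_one S = \<eta> S" by simp
qed

lemma d0_apply: "d0 f S = (if S = {CX} then pd CX f else if S = {CY1} then pd CY1 f
    else if S = {CY2} then pd CY2 f else 0)"
  by (auto simp: d0_def UNIV_coord simp del: pd.simps)

text \<open>The transverse Jacobian determinant: only the two splittings into singletons
  contribute.\<close>

lemma wedge_d0_CY1_CY2:
  "wedge (d0 f) (d0 g) {CY1, CY2} = pd CY1 f * pd CY2 g - pd CY2 f * pd CY1 g"
proof -
  have P: "Pow {CY1, CY2} = {{}, {CY1}, {CY2}, {CY1, CY2}}" by (auto simp: Pow_insert)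
  have "{(s, t). s \<in> {CY1} \<and> t \<in> {CY2} \<and> pos t < pos s} = {}" by auto
  then have 1: "inversions {CY1} {CY2} = 0" by (simp add: inversions_def)
  have "{(s, t). s \<in> {CY2} \<and> t \<in> {CY1} \<and> pos t < pos s} = {(CY2, CY1)}" by auto
  then have 2: "inversions {CY2} {CY1} = 1" by (simp add: inversions_def)
  have D: "{CY1, CY2} - {CY1} = {CY2}" "{CY1, CY2} - {CY2} = {CY1}" by auto
  show ?thesis
    unfolding wedge_def P
    by (simp add: d0_apply D 1 2 doubleton_eq_iff insert_eq_iff del: pd.simps)
qed

lemma pd_var: "pd s (var t) = (if s = t then 1 else 0)"
  by (rule ser_eqI; cases s; cases t; auto simp: mcoeff_var mcoeff_one simp del: var.simps)

lemma dy1_dy2_apply: "dy1_dy2 S = (if S = {CY1, CY2} then 1 else 0)"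
proof (cases "S = {CY1, CY2}")
  case True
  then show ?thesis by (simp add: dy1_dy2_def wedge_d0_CY1_CY2 pd_var del: pd.simps var.simps)
next
  case False
  have "d0 (var CY1) T * d0 (var CY2) (S - T) = 0" if "T \<subseteq> S" for T
    using False that by (auto simp: d0_apply pd_var simp del: pd.simps var.simps)
  then have "wedge (d0 (var CY1)) (d0 (var CY2)) S = 0"
    unfolding wedge_def mult.assoc
    by (intro sum.neutral ballI) (simp del: var.simps)
  then show ?thesis
    using False by (simp add: dy1_dy2_def)
qed

lemma pullback_dy1_dy2:
  assumes "fixes_origin \<Phi>"
  shows "pullback \<Phi> dy1_dy2 = wedge (d0 (\<Phi> CY1)) (d0 (\<Phi> CY2))"
proof
  fix T
  have "pullback \<Phi> dy1_dy2 T = (\<Sum>S\<in>UNIV. if S = {CY1, CY2} then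
      foldr (\<lambda>s. wedge (d0 (\<Phi> s))) (filter (\<lambda>s. s \<in> S) [CX, CY1, CY2]) form_one T else 0)"
    unfolding pullback_def by (intro sum.cong refl) (simp add: dy1_dy2_apply assms)
  then show "pullback \<Phi> dy1_dy2 T = wedge (d0 (\<Phi> CY1)) (d0 (\<Phi> CY2)) T"
    by (simp add: wedge_form_one)
qed

text \<open>The forms vanishing on all index sets without \<open>CX\<close> constitute an ideal
  containing dx, hence contain the ideal it generates.\<close>

lemma ideal_dx_apply:
  assumes "\<eta> \<in> ideal_dx" "CX \<notin> S"
  shows "\<eta> S = 0"
proof -
  let ?J = "{\<eta> :: form. \<forall>S. CX \<notin> S \<longrightarrow> \<eta> S = 0}"
  have "form_ideal ?J"
    by (auto simp: form_ideal_def wedge_def intro!: sum.neutral)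
  moreover have "d0 (var CX) \<in> ?J"
    by (auto simp: d0_apply pd_var simp del: pd.simps var.simps)
  ultimately show ?thesis using assms unfolding ideal_dx_def by blast
qed

lemma zero_in_ideal_dx: "(\<lambda>S. 0) \<in> ideal_dx"
  by (auto simp: ideal_dx_def form_ideal_def)

section \<open>Isotropies\<close>

lemma subst_Zfield:
  assumes "fixes_origin \<Phi>"
  shows "subst (Zfield l a1 a2 c CX) \<Phi> = \<Phi> CX ^ 2"
    and "subst (Zfield l a1 a2 c CY1) \<Phi>
      = (- (ser_const l + subst1 c (\<Phi> CY1 * \<Phi> CY2)) + ser_const a1 * \<Phi> CX) * \<Phi> CY1"
    and "subst (Zfield l a1 a2 c CY2) \<Phi>
      = (ser_const l + subst1 c (\<Phi> CY1 * \<Phi> CY2) + ser_const a2 * \<Phi> CX) * \<Phi> CY2"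
  using assms
  by (simp_all add: subst_mult subst_power subst_add subst_diff subst_uminus subst_var subst_ser_const
      subst_cser del: var.simps)

lemma Isot_omega_iff:
  "\<Phi> \<in> Isot_omega Z \<longleftrightarrow> fdiffeo \<Phi> \<and> \<Phi> CX = var CX
    \<and> (\<lambda>S. pullback \<Phi> dy1_dy2 S - dy1_dy2 S) \<in> ideal_dx
    \<and> (\<forall>s. der Z (\<Phi> s) = subst (Z s) \<Phi>)"
  using pushforward_eq_iff[of \<Phi> Z Z]
  by (auto simp: Isot_omega_def Diff_omega_def der_def subst_var fdiffeo_def simp del: var.simps)

section \<open>Diagonal maps\<close>

lemma fixes_origin_diag: "fixes_origin (diag 1 a b)"
  unfolding fixes_origin_def
proof
  fix s
  show "mcoeff (diag 1 a b s) 0 0 0 = 0"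
    by (cases s) (simp_all add: mcoeff_var del: var.simps)
qed

lemma fcomp_map_diag: "fcomp_map (diag 1 a b) (diag 1 a' b') = diag 1 (a * a') (b * b')"
proof
  fix s
  show "fcomp_map (diag 1 a b) (diag 1 a' b') s = diag 1 (a * a') (b * b') s"
    by (cases s) (simp_all add: fcomp_map_def subst_scale subst_var fixes_origin_diag
      mult.assoc[symmetric] ser_const_mult del: var.simps)
qed

lemma diag_one: "diag 1 1 1 = var"
proof
  show "diag 1 1 1 s = var s" for s
    by (cases s) (simp_all del: var.simps)
qed

text \<open>The map preserves v, hence c(v), and scales each component of Z as it scales the
  coordinate. Its transverse determinant is \<alpha> (1/\<alpha>) = 1, so dy1 dy2 is preserved
  exactly.\<close>

lemma diag_Isot_omega:
  assumes "\<alpha> \<noteq> 0"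
  shows "diag 1 \<alpha> (1 / \<alpha>) \<in> Isot_omega (Zfield l a1 a2 c)"
proof -
  let ?D = "diag 1 \<alpha> (1 / \<alpha>)"
  have pdc: "pd t (ser_const a * F) = ser_const a * pd t F" for t a F
    by (rule ser_eqI; cases t; simp)
  have derc: "der V (ser_const a * F) = ser_const a * der V F" for V a F
    by (simp add: der_expand pdc distrib_left mult.assoc del: pd.simps)
  have der_var: "der V (var s) = V s" for V s
    by (cases s) (simp_all add: der_expand pd_var del: pd.simps var.simps)
  have "is_finverse ?D (diag 1 (1 / \<alpha>) \<alpha>)"
    using assms by (simp add: is_finverse_def fixes_origin_diag fcomp_map_diag diag_one)
  then have diffeo: "fdiffeo ?D"
    by (auto simp: fdiffeo_def fixes_origin_diag)
  have "ser_const \<alpha> * var CY1 * (ser_const (1 / \<alpha>) * var CY2)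
      = (ser_const \<alpha> * ser_const (1 / \<alpha>)) * (var CY1 * var CY2)"
    by (simp only: mult_ac)
  then have prod: "?D CY1 * ?D CY2 = var CY1 * var CY2"
    using assms by (simp add: ser_const_mult del: var.simps)
  have "der (Zfield l a1 a2 c) (?D s) = subst (Zfield l a1 a2 c s) ?D" for s
    unfolding subst_Zfield[OF fixes_origin_diag]
    by (cases s; simp only: subst_Zfield[OF fixes_origin_diag] prod;
        simp add: derc der_var mult.left_commute del: var.simps)
  moreover have "pullback ?D dy1_dy2 = dy1_dy2"
  proof -
    have d0c: "d0 (ser_const a * F) S = ser_const a * d0 F S" for a F S
      by (simp add: d0_apply pdc del: pd.simps)
    have "wedge (d0 (?D CY1)) (d0 (?D CY2)) S
        = (ser_const \<alpha> * ser_const (1 / \<alpha>)) * wedge (d0 (var CY1)) (d0 (var CY2)) S" for S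
      by (simp only: wedge_def diag.simps d0c sum_distrib_left) (simp only: mult_ac)
    then show ?thesis
      unfolding pullback_dy1_dy2[OF fixes_origin_diag] using assms
      by (simp add: ser_const_mult dy1_dy2_def fun_eq_iff del: var.simps diag.simps)
  qed
  ultimately show ?thesis
    using diffeo zero_in_ideal_dx by (simp add: Isot_omega_iff del: var.simps)
qed

lemma Isot_omega_diag:
  assumes "l \<noteq> 0" "a1 + a2 = 1" "fps_nth c 0 = 0"
    and "\<Phi> \<in> Isot_omega (Zfield l a1 a2 c)"
  obtains \<alpha> where "\<alpha> \<noteq> 0" "\<Phi> = diag 1 \<alpha> (1 / \<alpha>)"
proof -
  let ?Z = "Zfield l a1 a2 c"
  define p where "p = \<Phi> CY1"
  define q where "q = \<Phi> CY2"
  define E where "E = subst1 c (p * q)"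
  have fo: "fixes_origin \<Phi>" and x: "\<Phi> CX = var CX"
    and ideal: "(\<lambda>S. pullback \<Phi> dy1_dy2 S - dy1_dy2 S) \<in> ideal_dx"
    and der: "der ?Z (\<Phi> s) = subst (?Z s) \<Phi>" for s
    using assms(4) by (auto simp: Isot_omega_iff fdiffeo_def)
  have derp: "der ?Z p = (- (ser_const l + E) + ser_const a1 * var CX) * p"
    and derq: "der ?Z q = (ser_const l + E + ser_const a2 * var CX) * q"
    using der[of CY1] der[of CY2] unfolding subst_Zfield[OF fo] x E_def p_def q_def by simp_all
  have low: "low 1 p" "low 1 q"
    using fo by (simp_all add: fixes_origin_low p_def q_def)
  then have low00: "mcoeff p 0 0 0 = 0" "mcoeff q 0 0 0 = 0"
    by (simp_all add: low_def)
  have low_pq: "low 2 (p * q)"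
    using low_mult[OF low] by (simp add: numeral_2_eq_2)
  have lowE: "low 1 E"
    using assms(3) by (simp add: E_def low_def subst1_def)

  \<comment> \<open>The component without dx is the transverse Jacobian condition; its constant term
    is the determinant of the linear part.\<close>
  have "pd CY1 p * pd CY2 q - pd CY2 p * pd CY1 q - 1 = 0"
    using ideal_dx_apply[OF ideal, of "{CY1, CY2}"]
    by (simp add: pullback_dy1_dy2 fo wedge_d0_CY1_CY2 dy1_dy2_apply p_def q_def del: pd.simps)
  from arg_cong[OF this, of "\<lambda>F. mcoeff F 0 0 0"]
  have det: "mcoeff p 0 1 0 * mcoeff q 0 0 1 - mcoeff p 0 0 1 * mcoeff q 0 1 0 = 1"
    by (simp add: mcoeff_mult mcoeff_one)

  text \<open>This excludes a linear part exchanging \<open>y\<^sub>1\<close> and \<open>y\<^sub>2\<close>, for which \<open>\<beta>\<close> would be \<open>- 1\<close>.\<close>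
  have p001: "mcoeff p 0 0 1 = 0"
  proof -
    have "low 1 (weight p)" "low 1 (cser c)"
      using low assms(3) by (simp_all add: low_def weight_def mcoeff_cser del: var.simps)
    then have "low 2 (cser c * weight p)" "low 2 (E * p)"
      using low_mult[of 1 "cser c" 1 "weight p"] low_mult[OF lowE low(1)]
      by (simp_all add: numeral_2_eq_2 del: var.simps)
    then have "mcoeff (cser c * weight p) 0 0 1 = 0" "mcoeff (E * p) 0 0 1 = 0"
      by (simp_all add: low_def del: var.simps)
    \<comment> \<open>The monomial y2 has weight 1, so the two sides of the equation for p give l
      and -l times the same coefficient; all other terms have order at least 2 or contain x.\<close>
    then have "mcoeff (der ?Z p) 0 0 1 = l * mcoeff p 0 0 1"
      and "mcoeff ((- (ser_const l + E) + ser_const a1 * var CX) * p) 0 0 1 = - l * mcoeff p 0 0 1"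
      unfolding der_Zfield
      by (simp_all add: distrib_right left_diff_distrib mult.assoc mcoeff_CX_mult weight_def
          del: var.simps)
    then show ?thesis using assms(1) derp by simp
  qed

  have "der ?Z (p * q) = (ser_const a1 + ser_const a2) * var CX * (p * q)"
    unfolding der_mult derp derq by (simp add: algebra_simps del: var.simps)
  also have "ser_const a1 + ser_const a2 = 1"
    using assms(2) by (intro ser_eqI) (auto simp: mcoeff_ser_const mcoeff_one)
  \<comment> \<open>The still unknown E has cancelled, which leaves the eigenvalue equation with m =
    0 and s = 1.\<close>
  finally have "der ?Z (p * q) = (ser_const 0 * (ser_const l + cser c) + ser_const 1 * var CX) * (p * q)"
    by simp
  note pq = Zfield_eigen[OF assms(1,3) this]
  have a2: "a2 = 1 - a1" using assms(2) by (simp add: algebra_simps)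
  \<comment> \<open>For k = j the relation a1 + a2 = 1 turns the second condition into i + j = 1.
    Its solutions are x and y1 y2, and the order of \<open>p * q\<close> excludes x.\<close>
  have pq0: "mcoeff (p * q) i j k = 0" if "\<not> (i = 0 \<and> j = 1 \<and> k = 1)" for i j k
  proof (cases "k = j")
    case True
    have "of_nat i + a1 * of_nat j + a2 * of_nat k - 1 = (of_nat (i + j) - 1 :: complex)"
      by (simp add: a2 True algebra_simps)
    with pq(2)[of i j k] have "(of_nat (i + j) - 1) * mcoeff (p * q) i j k = 0"
      by (simp only:)
    then have *: "mcoeff (p * q) i j k = 0" if "i + j \<noteq> 1"
      using that of_nat_eq_1_iff[of "i + j", where ?'a = complex] by (simp del: of_nat_add)
    have "mcoeff (p * q) 1 0 0 = 0" using low_pq by (simp add: low_def)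
    then show ?thesis using * that True by (cases "i + j = 1") (auto simp: add_is_1)
  next
    case False
    then show ?thesis using pq(1)[of k j i] by simp
  qed
  \<comment> \<open>Without the crossed product the coefficient of v in \<open>p * q\<close> is the
    determinant itself.\<close>
  have "mcoeff (p * q) 0 1 1 = mcoeff p 0 1 0 * mcoeff q 0 0 1"
    using low00 p001 by (simp add: mcoeff_mult)
  then have pq011: "mcoeff (p * q) 0 1 1 = 1" using det p001 by simp
  have "p * q = var CY1 * var CY2"
  proof (rule ser_eqI)
    fix i j k
    show "mcoeff (p * q) i j k = mcoeff (var CY1 * var CY2) i j k"
      using pq0[of i j k] pq011
      by (cases j) (auto simp: mcoeff_CY1_mult mcoeff_var simp del: var.simps)
  qed
  \<comment> \<open>Both equations now have the form of \<open>Zfield_eigen\<close>, with (m, s) =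
    (-1, a1) for p and (1, a2) for q.\<close>
  then have E: "E = cser c" by (simp add: E_def)

  have "der ?Z p = (ser_const (- 1) * (ser_const l + cser c) + ser_const a1 * var CX) * p"
  proof -
    have "ser_const (- 1) = - 1" by (rule ser_eqI) (simp add: mcoeff_ser_const mcoeff_one)
    then show ?thesis using derp by (simp add: E del: var.simps)
  qed
  note eigp = Zfield_eigen[OF assms(1,3) this]
  have "der ?Z q = (ser_const 1 * (ser_const l + cser c) + ser_const a2 * var CX) * q"
    using derq by (simp add: E del: var.simps)
  note eigq = Zfield_eigen[OF assms(1,3) this]
  \<comment> \<open>On the line j = k + 1 the second factor is the integer i + k, zero only at i = k
    = 0. For q the line is k = j + 1 and the factor i + j.\<close>
  have p0: "mcoeff p i j k = 0" if "\<not> (i = 0 \<and> j = 1 \<and> k = 0)" for i j k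
  proof (cases "j = k + 1")
    case True
    have "of_nat i + a1 * of_nat j + a2 * of_nat k - a1 = (of_nat (i + k) :: complex)"
      by (simp add: a2 True algebra_simps)
    then show ?thesis using eigp(2)[of i j k] that True by (auto simp del: of_nat_add)
  next
    case False
    then have "of_nat k - of_nat j - (- 1) \<noteq> (0 :: complex)"
      using of_nat_eq_iff[of j "k + 1", where ?'a = complex] by (auto simp: algebra_simps)
    then show ?thesis using eigp(1)[of k j i] by simp
  qed
  have q0: "mcoeff q i j k = 0" if "\<not> (i = 0 \<and> j = 0 \<and> k = 1)" for i j k
  proof (cases "k = j + 1")
    case True
    have "of_nat i + a1 * of_nat j + a2 * of_nat k - a2 = (of_nat (i + j) :: complex)"
      by (simp add: a2 True algebra_simps)
    then show ?thesis using eigq(2)[of i j k] that True by (auto simp del: of_nat_add)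
  next
    case False
    then have "of_nat k - of_nat j - 1 \<noteq> (0 :: complex)"
      using of_nat_eq_iff[of k "j + 1", where ?'a = complex] by (auto simp: algebra_simps)
    then show ?thesis using eigq(1)[of k j i] by simp
  qed
  define \<alpha> where "\<alpha> = mcoeff p 0 1 0"
  have prod: "\<alpha> * mcoeff q 0 0 1 = 1" using det p001 by (simp add: \<alpha>_def)
  then have nz: "\<alpha> \<noteq> 0" and q001: "mcoeff q 0 0 1 = 1 / \<alpha>"
    by (auto simp: eq_divide_eq mult.commute)
  have "p = ser_const \<alpha> * var CY1"
    by (rule ser_eqI) (use p0 in \<open>auto simp: mcoeff_var \<alpha>_def simp del: var.simps\<close>)
  moreover have "q = ser_const (1 / \<alpha>) * var CY2"
    by (rule ser_eqI) (use q0 q001 in \<open>auto simp: mcoeff_var simp del: var.simps\<close>)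
  ultimately have "\<Phi> s = diag 1 \<alpha> (1 / \<alpha>) s" for s
    by (cases s) (simp_all add: x p_def q_def del: var.simps)
  then show thesis using that nz by blast
qed

text \<open>The parameter \<alpha> is read off as the coefficient of y1 in the second component of
  the map; composition multiplies the parameters.\<close>

lemma Isot_group_iso_Cstar:
  assumes "Isot_omega Z = {diag 1 \<alpha> (1 / \<alpha>) | \<alpha>. \<alpha> \<in> UNIV - {0}}"
  shows "Isot_group Z \<cong> Cstar"
proof -
  define h where "h = (\<lambda>\<Phi> :: fmap. mcoeff (\<Phi> CY1) 0 1 0)"
  have h: "h (diag 1 a b) = a" for a b
    by (simp add: h_def mcoeff_var del: var.simps)
  have "h \<in> hom (Isot_group Z) Cstar"
    by (rule homI) (auto simp: Isot_group_def Cstar_def assms fcomp_map_diag h simp del: diag.simps)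
  moreover have "bij_betw h (carrier (Isot_group Z)) (carrier Cstar)"
    by (rule bij_betw_byWitness[where f' = "\<lambda>a. diag 1 a (1 / a)"])
      (auto simp: Isot_group_def Cstar_def assms h)
  ultimately show ?thesis
    by (auto simp: is_iso_def iso_def)
qed

theorem proposition3p6:
  fixes l a1 a2 :: complex and c :: "complex fps"
  assumes "l \<noteq> 0"
    and "a1 + a2 = 1"
    and "fps_nth c 0 = 0"
  shows "Isot_omega (Zfield l a1 a2 c) = {diag 1 \<alpha> (1 / \<alpha>) | \<alpha>. \<alpha> \<in> UNIV - {0}}
    \<and> Isot_group (Zfield l a1 a2 c) \<cong> Cstar"
proof -
  have "Isot_omega (Zfield l a1 a2 c) = {diag 1 \<alpha> (1 / \<alpha>) | \<alpha>. \<alpha> \<in> UNIV - {0}}"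
    using diag_Isot_omega Isot_omega_diag[OF assms] by (auto; metis)
  then show ?thesis using Isot_group_iso_Cstar by blast
qed

end
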